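(* Consider the cyclic manufacturing system (without transportation delay) of $N$ production processes with homogeneous production control gain $h^i=h\in(0,1)$ for all $i$, described in the context. Let $\gamma_m=\frac{1}{2(1-h)}$. Suppose that, for every route $i\to j$ (i.e. $j=i+1$ for $1\le i\le N-1$, and $j=1$ for $i=N$), the transportation controller $\mathcal{C}_\tau^{i\to j}$ is designed such that: (i) $\mathcal{C}_\tau^{i\to j}$ is a single-input single-output memoryless map with input $y_c^{i\to j}(t)\in\mathbb{R}$ and output $u_c^{i\to j}(t)\in[-1,1]$; (ii) the cascade connection of $\mathcal{C}_\tau^{i\to j}$ and the stochastic actuator $\mathcal{T}^{i\to j}$, a memoryless stochastic map with input $y_c^{i\to j}(t)$ and output $u_a^{i\to j}(t)$, satisfies $E[u_a^{i\to j}(t)\,y_c^{i\to j}(t)]\ge\delta\,E[(u_a^{i\to j}(t))^2]$ (for every value of the input $y_c^{i\to j}(t)$), where $\delta\ge2\gamma_m$. Let $\bar x=\big(\tfrac{1}{2N}\mathbf{1}_{2N}^Tx(0)\big)\mathbf{1}_{2N}$, where $\mathbf{1}_{2N}\in\mathbb{R}^{2N}$ is the all-one column vector and $x(0)$ is the initial state, and let $\tilde x(t)=x(t)-\bar x$. Then $$E\big[V(\tilde x(t+1))\,\big|\,\tilde x(t)\big]-V(\tilde x(t))\le0\quad\text{for all }t,\qquad V(\tilde x(t))=0.5\,\tilde x^T(t)\tilde x(t).$$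
   Context: System. The state is $x=[x^{1T},\dots,x^{NT}]^T\in\mathbb{R}^{2N}$ with $x^i=[x_I^i,\ x_O^i]^T$ (stock levels of the input and output buffers of process $i$). The dynamics, started from a given initial state $x(0)$, is $$x(t+1)=Ax(t)+Bu_a(t),\qquad A=\mathrm{diag}\{A^1,\dots,A^N\},\quad A^i=\begin{bmatrix} 1-h & h \\ h & 1-h \end{bmatrix},$$ where $u_a(t)=[u_a^{1\to2}(t),u_a^{2\to3}(t),\dots,u_a^{N\to1}(t)]^T\in\mathbb{R}^N$ and $B\in\mathbb{R}^{2N\times N}$ is the incidence matrix: the column of route $i\to j$ has entry $-1$ in the row of $x_O^i$, entry $+1$ in the row of $x_I^j$, and $0$ elsewhere. (Thus materials leave the output buffer of $i$ and enter the input buffer of $j$.) Feedback. The controller inputs are the components of $y_c(t)=-B^Tx(t)$, i.e. $y_c^{i\to j}(t)=x_O^i(t)-x_I^j(t)$; then $u_c^{i\to j}(t)=\mathcal{C}_\tau^{i\to j}(y_c^{i\to j}(t))$ (a deterministic function) and $u_a^{i\to j}(t)=\mathcal{T}^{i\to j}(u_c^{i\to j}(t))$. Stochastic actuator. For input $u_c\in[-1,1]$, $\mathcal{T}^{i\to j}(u_c)$ is a random variable with values in $\{+1,0,-1\}$: it equals $+1$ with probability $\max(u_c,0)$, $-1$ with probability $\max(-u_c,0)$, and $0$ with probability $1-|u_c|$. Expectations in (ii) are over this randomness for the given value of $y_c^{i\to j}(t)$; conditionally on $x(t)$, each $u_a^{i\to j}(t)$ equals $+1$ with probability $\max(u_c^{i\to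 j}(t),0)$, $-1$ with probability $\max(-u_c^{i\to j}(t),0)$, and $0$ with probability $1-|u_c^{i\to j}(t)|$. *)

theory Defs
  imports "HOL-Probability.Probability"
begin

text \<open>
  Each process has an input and an output buffer; the state space \<open>\<real>\<^sup>2\<^sup>N\<close> is
  indexed by pairs of a process and a buffer, where \<open>N = CARD('n)\<close>.
\<close>

datatype buffer = Inp | Outp

instance buffer :: finite
proof
  have "(UNIV :: buffer set) = {Inp, Outp}"
    using buffer.exhaust by auto
  then show "finite (UNIV :: buffer set)"
    by (metis finite.emptyI finite.insertI)
qed

type_synonym 'n state = "real ^ ('n \<times> buffer)"

text \<open>
  The linear order on the finite index type plays the role of the numbering
  \<open>1, \<dots>, N\<close>. The routes are \<open>i \<rightarrow> next_process i\<close>, and a route is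
  indexed by its source \<open>i\<close>. For \<open>N = 1\<close> the only route is a self-loop.
\<close>

definition next_process :: "'n \<Rightarrow> 'n::{finite,linorder}" where
  "next_process i = (if i = Max UNIV then Min UNIV else Min {i<..})"

definition A_block :: "real \<Rightarrow> real ^ buffer ^ buffer" where
  "A_block h = (\<chi> r c. if r = c then 1 - h else h)"

definition A_mat :: "real \<Rightarrow> real ^ ('n::finite \<times> buffer) ^ ('n::finite \<times> buffer)" where
  "A_mat h = (\<chi> r c. if fst r = fst c then A_block h $ snd r $ snd c else 0)"

definition B_mat :: "real ^ ('n::{finite,linorder}) ^ ('n::{finite,linorder} \<times> buffer)" where
  "B_mat = (\<chi> r i. if r = (i, Outp) then - 1
                   else if r = (next_process i, Inp) then 1 else 0)"

definition controller_input :: "'n::{finite,linorder} state \<Rightarrow> real ^ ('n::{finite,linorder})" where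
  "controller_input x = - (transpose B_mat *v x)"

text \<open>
  The law of the stochastic actuator. \<^const>\<open>pmf_of_list\<close> is meaningful only for
  weights forming a probability vector, that is, for inputs in \<open>[-1, 1]\<close>.
\<close>

definition actuator :: "real \<Rightarrow> real pmf" where
  "actuator uc = pmf_of_list [(1, max uc 0), (-1, max (- uc) 0), (0, 1 - \<bar>uc\<bar>)]"

lemma pmf_actuator:
  assumes "uc \<in> {-1..1}"
  shows "pmf (actuator uc) v =
    (if v = 1 then max uc 0 else if v = -1 then max (- uc) 0
     else if v = 0 then 1 - \<bar>uc\<bar> else 0)"
proof -
  have "pmf_of_list_wf [(1::real, max uc 0), (-1, max (- uc) 0), (0, 1 - \<bar>uc\<bar>)]"
    using assms by (auto simp: pmf_of_list_wf_def max_def abs_if)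
  then show ?thesis
    by (auto simp: actuator_def pmf_pmf_of_list)
qed

lemma controller_input_component:
  fixes x :: "'n::{finite,linorder} state"
  shows "controller_input x $ i = x $ (i, Outp) - x $ (next_process i, Inp)"
proof -
  have "(transpose B_mat *v x) $ i =
    (\<Sum>r\<in>UNIV. (if r = (next_process i, Inp) then x $ r else 0) -
                (if r = (i, Outp) then x $ r else 0))"
    unfolding matrix_vector_mult_def transpose_def B_mat_def
    by (auto intro!: sum.cong)
  also have "\<dots> = x $ (next_process i, Inp) - x $ (i, Outp)"
    by (simp add: sum_subtractf sum.delta)
  finally show ?thesis
    by (simp add: controller_input_def)
qed

definition gamma_m :: "real \<Rightarrow> real" where
  "gamma_m h = 1 / (2 * (1 - h))"

definition ones :: "real ^ 'k::finite" where
  "ones = (\<chi> _. 1)"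

definition xbar :: "'n::finite state \<Rightarrow> 'n state" where
  "xbar x0 = (1 / (2 * real CARD('n)) * (ones \<bullet> x0)) *\<^sub>R ones"

definition V :: "'n::finite state \<Rightarrow> real" where
  "V x = 1 / 2 * (x \<bullet> x)"

end

theory Submission
  imports Defs
begin

text \<open>
  With \<open>d\<^sub>i = x\<^sub>I\<^sup>i - x\<^sub>O\<^sup>i\<close>, the increment of \<open>V\<close> along the dynamics is a sum over the processes
  of quadratic forms in \<open>d\<^sub>i\<close> and the inputs of the two routes meeting at process \<open>i\<close>.
  The contraction of \<open>A\<close> contributes \<open>- h (1 - h) d\<^sub>i\<^sup>2\<close>, and completing the square
  absorbs the cross terms, so that surely
  \<open>V(\<xi>(t+1)) - V(\<xi>(t)) \<le> \<Sum>\<^sub>i (u\<^sub>i\<^sup>2 / (1 - h) - u\<^sub>i y\<^sub>i)\<close>, where \<open>\<xi> = x - xbar\<close>.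
  Since \<open>\<delta> \<ge> 2 \<gamma>\<^sub>m = 1 / (1 - h)\<close>, hypothesis (ii) says that
  every summand on the right has nonpositive conditional expectation given the state.
\<close>

text \<open>For \<open>i < j\<close> the successor of \<open>i\<close> is at most \<open>j\<close>,
  while that of \<open>j\<close> exceeds \<open>j\<close>; if \<open>j\<close> is the maximum, its
  successor wraps around to the minimum, which is at most \<open>i\<close> and hence below the
  successor of \<open>i\<close>. This gives injectivity, and finiteness gives surjectivity. Thus
  every process has exactly one incoming route, and sums over routes may be indexed by source or by
  target.\<close>

lemma bij_next_process: "bij (next_process :: 'n \<Rightarrow> 'n::{finite,linorder})"
proof -
  have gt: "i < next_process i" if "i \<noteq> Max UNIV" for i :: 'n
  proof -
    have "Max UNIV \<in> {i<..}"
      using that Max_ge[of UNIV i] by (auto simp: less_le)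
    then have "{i<..} \<noteq> {}" by blast
    then have "Min {i<..} \<in> {i<..}" by (intro Min_in) auto
    then show ?thesis using that by (simp add: next_process_def)
  qed
  have le: "next_process i \<le> j" if "i < j" for i j :: 'n
  proof -
    have "i \<noteq> Max UNIV" using that Max_ge[of UNIV j] by auto
    then show ?thesis using that by (simp add: next_process_def)
  qed
  have neq: "next_process i \<noteq> next_process j" if "i < j" for i j :: 'n
  proof (cases "j = Max UNIV")
    case True
    have "i \<noteq> Max UNIV" using that True by auto
    moreover have "next_process j \<le> i" using True by (simp add: next_process_def)
    ultimately show ?thesis using gt[of i] by auto
  next
    case False
    then show ?thesis using gt[of j] le[OF that] by auto
  qed
  have "inj (next_process :: 'n \<Rightarrow> 'n)"
    by (rule injI) (metis neq linorder_neqE)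
  then show ?thesis by (simp add: bij_def finite_UNIV_inj_surj)
qed

section \<open>The system matrices in coordinates\<close>

lemma UNIV_buffer: "(UNIV :: buffer set) = {Inp, Outp}"
  using buffer.exhaust by auto

lemma sum_process_buffer:
  fixes f :: "'n::finite \<times> buffer \<Rightarrow> 'a::comm_monoid_add"
  shows "(\<Sum>r\<in>UNIV. f r) = (\<Sum>i\<in>UNIV. f (i, Inp) + f (i, Outp))"
proof -
  have "(\<Sum>r\<in>UNIV. f r) = (\<Sum>i\<in>UNIV. \<Sum>b\<in>UNIV. f (i, b))"
    by (simp add: sum.cartesian_product flip: UNIV_Times_UNIV)
  then show ?thesis by (simp add: UNIV_buffer)
qed

lemma A_mat_component:
  fixes x :: "'n::finite state"
  shows "(A_mat h *v x) $ (i, Inp) = x $ (i, Inp) - h * (x $ (i, Inp) - x $ (i, Outp))"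
    and "(A_mat h *v x) $ (i, Outp) = x $ (i, Outp) + h * (x $ (i, Inp) - x $ (i, Outp))"
proof -
  have *: "(A_mat h *v x) $ (i, b) = (\<Sum>j\<in>UNIV. if j = i
      then A_block h $ b $ Inp * x $ (i, Inp) + A_block h $ b $ Outp * x $ (i, Outp) else 0)" for b
    unfolding matrix_vector_mult_def A_mat_def vec_lambda_beta sum_process_buffer
    by (rule sum.cong) auto
  show "(A_mat h *v x) $ (i, Inp) = x $ (i, Inp) - h * (x $ (i, Inp) - x $ (i, Outp))"
    and "(A_mat h *v x) $ (i, Outp) = x $ (i, Outp) + h * (x $ (i, Inp) - x $ (i, Outp))"
    by (simp_all add: * A_block_def algebra_simps)
qed

lemma A_mat_ones: "A_mat h *v ones = ones"
proof -
  have "(A_mat h *v ones) $ (i, b) = ones $ (i, b)" for i and b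
    by (cases b) (simp_all add: A_mat_component ones_def)
  then show ?thesis by (auto simp: vec_eq_iff)
qed

text \<open>Each row of \<open>A_mat h\<close> sums to 1, so multiples of \<open>ones\<close> are
  fixed. The deviation from \<open>xbar x0\<close> therefore obeys the same recursion as the
  state.\<close>

lemma A_mat_xbar: "A_mat h *v xbar x0 = xbar x0"
  by (simp add: xbar_def scaleR_vector_matrix_assoc matrix_vector_mult_scaleR A_mat_ones)

lemma B_mat_component:
  fixes u :: "real ^ ('n::{finite,linorder})"
  shows "(B_mat *v u) $ (i, Outp) = - u $ i"
    and "(B_mat *v u) $ (next_process i, Inp) = u $ i"
proof -
  have "(B_mat *v u) $ (i, Outp) = (\<Sum>j\<in>UNIV. if j = i then - u $ i else 0)"
    unfolding matrix_vector_mult_def B_mat_def vec_lambda_beta by (intro sum.cong) auto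
  then show "(B_mat *v u) $ (i, Outp) = - u $ i" by simp
  \<comment> \<open>Injectivity ensures that no second route enters the same input buffer.\<close>
  have "next_process i = next_process j \<longleftrightarrow> i = j" for j
    using bij_next_process by (metis bij_def injD)
  then have "(B_mat *v u) $ (next_process i, Inp) = (\<Sum>j\<in>UNIV. if j = i then u $ i else 0)"
    unfolding matrix_vector_mult_def B_mat_def vec_lambda_beta by (intro sum.cong) auto
  then show "(B_mat *v u) $ (next_process i, Inp) = u $ i" by simp
qed

text \<open>This is a deterministic bound, valid for arbitrary real flows \<open>u\<close>. The
  quadratic cost of a route is shared equally between its two end processes, so the estimate can be
  proved one process at a time.\<close>

lemma V_step_le:
  fixes z :: "'n::{finite,linorder} state"
  assumes h: "0 < h" "h < 1"
  shows "V (A_mat h *v z + B_mat *v u)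
    \<le> V z + (\<Sum>i\<in>UNIV. (u $ i)\<^sup>2 / (1 - h) - u $ i * controller_input z $ i)"
proof -
  let ?p = "inv (next_process :: 'n \<Rightarrow> 'n)"
  note bij = bij_next_process[where 'n = 'n]
  have next_p: "next_process (?p i) = i" for i
    using bij by (simp add: bij_def surj_f_inv_f)
  have p_next: "?p (next_process i) = i" for i
    using bij by (simp add: bij_def inv_f_f)
  have B_in: "(B_mat *v u) $ (i, Inp) = u $ ?p i" for i
    using B_mat_component(2)[of u "?p i"] by (simp add: next_p)
  have reindex: "(\<Sum>i\<in>UNIV. f (next_process i)) = (\<Sum>i\<in>UNIV. f i)" for f :: "'n \<Rightarrow> real"
    using sum.reindex_bij_betw[OF bij, of f] by simp
  \<comment> \<open>For one process, \<open>a\<close> and \<open>b\<close> are the output and input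
    levels, \<open>v\<close> the outgoing and \<open>w\<close> the incoming flow. Each flow is
    charged half of its cost \<open>1 / (1 - h)\<close>.\<close>
  define c where "c a b v w = v\<^sup>2 / (2 * (1 - h)) + w\<^sup>2 / (2 * (1 - h)) - v * a + w * b"
    for a b v w :: real
  have square: "1 / 2 * (b - h * (b - a) + w)\<^sup>2 + 1 / 2 * (a + h * (b - a) - v)\<^sup>2
      \<le> 1 / 2 * b\<^sup>2 + 1 / 2 * a\<^sup>2 + c a b v w" for a b v w :: real
  proof -
    \<comment> \<open>The slack in the bound is a sum of two squares times
      \<open>h / (1 - h)\<close>. Writing \<open>k\<close> for \<open>1 - h\<close> leaves a single
      variable as denominator.\<close>
    have *: "v\<^sup>2 / (2 * k) + w\<^sup>2 / (2 * k) - v * a + w * b + 1 / 2 * b\<^sup>2 + 1 / 2 * a\<^sup>2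
        - (1 / 2 * (b - (1 - k) * (b - a) + w)\<^sup>2 + 1 / 2 * (a + (1 - k) * (b - a) - v)\<^sup>2)
      = (1 - k) / k * ((k * (b - a) + (v + w) / 2)\<^sup>2 + ((v - w) / 2)\<^sup>2)" if "k \<noteq> 0" for k
      using that by (simp add: field_simps power2_eq_square)
    have "1 / 2 * b\<^sup>2 + 1 / 2 * a\<^sup>2 + c a b v w
        - (1 / 2 * (b - h * (b - a) + w)\<^sup>2 + 1 / 2 * (a + h * (b - a) - v)\<^sup>2)
      = h / (1 - h) * (((1 - h) * (b - a) + (v + w) / 2)\<^sup>2 + ((v - w) / 2)\<^sup>2)"
      using h *[of "1 - h"] unfolding c_def by simp
    moreover have "\<dots> \<ge> 0" using h by (intro mult_nonneg_nonneg) auto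
    ultimately show ?thesis by linarith
  qed
  have "V (A_mat h *v z + B_mat *v u) =
      (\<Sum>i\<in>UNIV. 1 / 2 * (z $ (i, Inp) - h * (z $ (i, Inp) - z $ (i, Outp)) + u $ ?p i)\<^sup>2
        + 1 / 2 * (z $ (i, Outp) + h * (z $ (i, Inp) - z $ (i, Outp)) - u $ i)\<^sup>2)"
    by (simp add: V_def inner_vec_def sum_process_buffer A_mat_component B_mat_component(1) B_in
        power2_eq_square sum_divide_distrib add_divide_distrib)
  also have "\<dots> \<le> (\<Sum>i\<in>UNIV. 1 / 2 * (z $ (i, Inp))\<^sup>2 + 1 / 2 * (z $ (i, Outp))\<^sup>2
      + c (z $ (i, Outp)) (z $ (i, Inp)) (u $ i) (u $ ?p i))"
    by (intro sum_mono square)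
  also have "\<dots> = V z + (\<Sum>i\<in>UNIV. c (z $ (i, Outp)) (z $ (i, Inp)) (u $ i) (u $ ?p i))"
    by (simp add: V_def inner_vec_def sum_process_buffer power2_eq_square sum.distrib
        sum_divide_distrib add_divide_distrib)
  also have "(\<Sum>i\<in>UNIV. c (z $ (i, Outp)) (z $ (i, Inp)) (u $ i) (u $ ?p i))
      = (\<Sum>i\<in>UNIV. (u $ i)\<^sup>2 / (2 * (1 - h)) - u $ i * z $ (i, Outp))
      + (\<Sum>i\<in>UNIV. (u $ ?p i)\<^sup>2 / (2 * (1 - h)) + u $ ?p i * z $ (i, Inp))"
    unfolding c_def by (simp flip: sum.distrib add: algebra_simps)
  \<comment> \<open>Charges for incoming flow move from the receiving process to the source of the
    route, where they combine with the outgoing charges into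
    \<open>controller_input\<close>.\<close>
  also have "(\<Sum>i\<in>UNIV. (u $ ?p i)\<^sup>2 / (2 * (1 - h)) + u $ ?p i * z $ (i, Inp))
      = (\<Sum>i\<in>UNIV. (u $ i)\<^sup>2 / (2 * (1 - h)) + u $ i * z $ (next_process i, Inp))"
    by (subst reindex[symmetric]) (simp add: p_next)
  also have "(\<Sum>i\<in>UNIV. (u $ i)\<^sup>2 / (2 * (1 - h)) - u $ i * z $ (i, Outp)) + \<dots>
      = (\<Sum>i\<in>UNIV. (u $ i)\<^sup>2 / (1 - h) - u $ i * controller_input z $ i)"
  proof -
    have half: "r / (2 * (1 - h)) + r / (2 * (1 - h)) = r / (1 - h)" for r
      using mult_divide_mult_cancel_left[of 2 r "1 - h"] by simp
    show ?thesis
      unfolding controller_input_component half[symmetric] sum.distrib[symmetric]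
      by (rule sum.cong) (auto simp: right_diff_distrib)
  qed
  finally show ?thesis .
qed

text \<open>The input on each route is a difference of two levels, so a shift common to all buffers
  cancels.\<close>

lemma controller_input_xbar: "controller_input (x - xbar x0) = controller_input x"
  by (simp add: vec_eq_iff controller_input_component xbar_def ones_def)

text \<open>The positive and negative parts of \<open>c\<close> differ by \<open>c\<close> and add
  up to its absolute value. Hypothesis (ii) thereby becomes
  \<open>\<delta> * \<bar>c\<bar> \<le> c * y\<close>.\<close>

lemma expectation_actuator:
  assumes "c \<in> {-1..1}"
  shows "measure_pmf.expectation (actuator c) (\<lambda>u. u * y) = c * y"
    and "measure_pmf.expectation (actuator c) (\<lambda>u. u\<^sup>2) = \<bar>c\<bar>"
proof -
  have supp: "v \<in> {1, -1, 0}" if "v \<in> set_pmf (actuator c)" for v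
    using that assms by (auto simp: set_pmf_iff pmf_actuator split: if_splits)
  have *: "measure_pmf.expectation (actuator c) f
      = f 1 * max c 0 + f (-1) * max (- c) 0 + f 0 * (1 - \<bar>c\<bar>)" for f :: "real \<Rightarrow> real"
    by (subst integral_measure_pmf_real[where A = "{1, -1, 0}"])
       (use supp assms in \<open>auto simp: pmf_actuator algebra_simps\<close>)
  show "measure_pmf.expectation (actuator c) (\<lambda>u. u * y) = c * y"
    and "measure_pmf.expectation (actuator c) (\<lambda>u. u\<^sup>2) = \<bar>c\<bar>"
    unfolding * by (auto simp: max_def abs_if)
qed

text \<open>A translation is continuous with continuous inverse, so it generates the same events.
  Conditioning on the deviation thus agrees with conditioning on the state, which is the form of
  \<open>u_law\<close>.\<close>

lemma vimage_algebra_diff_const: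
  fixes f :: "'w \<Rightarrow> 'a::real_normed_vector"
  shows "vimage_algebra X (\<lambda>\<omega>. f \<omega> - c) borel = vimage_algebra X f borel"
proof -
  have sub: "sets (vimage_algebra X (\<lambda>\<omega>. g \<omega> - c) borel) \<subseteq> sets (vimage_algebra X g borel)"
    for g :: "'w \<Rightarrow> 'a" and c
  proof -
    have "(\<lambda>\<omega>. g \<omega> - c) \<in> vimage_algebra X g borel \<rightarrow>\<^sub>M borel"
      by (rule measurable_compose[OF measurable_vimage_algebra1])
         (auto intro!: borel_measurable_continuous_onI continuous_intros)
    then show ?thesis
      by (simp add: sets_image_in_sets)
  qed
  have "sets (vimage_algebra X (\<lambda>\<omega>. f \<omega> - c) borel) = sets (vimage_algebra X f borel)"
    using sub[of f c] sub[of "\<lambda>\<omega>. f \<omega> - c" "- c"] by auto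
  then show ?thesis
    \<comment> \<open>Equality as measures also requires equal \<open>emeasure\<close>; it is zero
      on both sides.\<close>
    by (rule measure_eqI) (simp add: vimage_algebra_def emeasure_sigma)
qed

theorem proposition7:
  fixes M :: "'w measure"
    and h \<delta> :: real
    and C :: "'n::{finite,linorder} \<Rightarrow> real \<Rightarrow> real"
    and x0 :: "'n state"
    and x :: "nat \<Rightarrow> 'w \<Rightarrow> 'n state"
    and u\<^sub>a :: "nat \<Rightarrow> 'w \<Rightarrow> real ^ ('n::{finite,linorder})"
  assumes "prob_space M"
    and "0 < h" and "h < 1"
    and init: "\<And>\<omega>. \<omega> \<in> space M \<Longrightarrow> x 0 \<omega> = x0"
    and dynamics: "\<And>t \<omega>. \<omega> \<in> space M \<Longrightarrow> x (Suc t) \<omega> = A_mat h *v x t \<omega> + B_mat *v u\<^sub>a t \<omega>"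
    and u_measurable: "\<And>t. u\<^sub>a t \<in> borel_measurable M"
    and u_values: "\<And>t \<omega> i. \<omega> \<in> space M \<Longrightarrow> u\<^sub>a t \<omega> $ i \<in> {1, 0, -1}"
    and u_law: "\<And>t i v. AE \<omega> in M.
      real_cond_exp M (vimage_algebra (space M) (x t) borel)
        (indicator {\<omega>' \<in> space M. u\<^sub>a t \<omega>' $ i = v}) \<omega>
      = pmf (actuator (C i (controller_input (x t \<omega>) $ i))) v"
    and C_range: "\<And>i y. C i y \<in> {-1..1}"
    and C_cascade: "\<And>i y.
      measure_pmf.expectation (actuator (C i y)) (\<lambda>u. u * y)
      \<ge> \<delta> * measure_pmf.expectation (actuator (C i y)) (\<lambda>u. u\<^sup>2)"
    and "\<delta> \<ge> 2 * gamma_m h"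
  shows "\<forall>t. AE \<omega> in M.
    real_cond_exp M (vimage_algebra (space M) (\<lambda>\<omega>'. x t \<omega>' - xbar x0) borel)
        (\<lambda>\<omega>'. V (x (Suc t) \<omega>' - xbar x0)) \<omega>
      - V (x t \<omega> - xbar x0) \<le> 0"
proof
  fix t
  interpret prob_space M by fact
  define F where "F = vimage_algebra (space M) (x t) borel"
  define y where "y i \<omega> = controller_input (x t \<omega>) $ i" for i \<omega>
  \<comment> \<open>A deterministic start and flows bounded by 1 keep the state bounded at each
    fixed time, with \<open>K\<close> depending on \<open>s\<close>. All integrability below rests
    on this.\<close>
  have "x s \<in> borel_measurable M \<and> (\<exists>K. \<forall>\<omega>\<in>space M. norm (x s \<omega>) \<le> K)" for s
  proof (induction s)
    case 0
    have "x 0 \<in> borel_measurable M \<longleftrightarrow> (\<lambda>_. x0) \<in> borel_measurable M"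
      by (rule measurable_cong) (rule init)
    moreover have "\<forall>\<omega>\<in>space M. norm (x 0 \<omega>) \<le> norm x0" by (simp add: init)
    ultimately show ?case using borel_measurable_const by blast
  next
    case (Suc s)
    then obtain K where K: "\<And>\<omega>. \<omega> \<in> space M \<Longrightarrow> norm (x s \<omega>) \<le> K" by blast
    have lin: "bounded_linear ((*v) (A_mat h ::
        real ^ ('n::{finite,linorder} \<times> buffer) ^ ('n::{finite,linorder} \<times> buffer)))"
      "bounded_linear ((*v) (B_mat :: real ^ ('n::{finite,linorder}) ^ ('n::{finite,linorder} \<times> buffer)))"
      by (rule matrix_vector_mul_bounded_linear)+
    obtain a where a: "\<And>v. norm (A_mat h *v v :: 'n::{finite,linorder} state) \<le> norm v * a" and "0 \<le> a"
      using bounded_linear.nonneg_bounded[OF lin(1)] by blast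
    obtain b where b: "\<And>v. norm (B_mat *v v :: 'n::{finite,linorder} state) \<le> norm v * b" and "0 \<le> b"
      using bounded_linear.nonneg_bounded[OF lin(2)] by blast
    have "norm (x (Suc s) \<omega>) \<le> K * a + real CARD('n) * b" if w: "\<omega> \<in> space M" for \<omega>
    proof -
      have "\<bar>u\<^sub>a s \<omega> $ i\<bar> \<le> 1" for i using u_values[OF w, of s i] by auto
      then have "(\<Sum>i\<in>UNIV. \<bar>u\<^sub>a s \<omega> $ i\<bar>) \<le> (\<Sum>i\<in>(UNIV :: 'n set). 1)"
        by (intro sum_mono)
      then have "norm (u\<^sub>a s \<omega>) \<le> real CARD('n)"
        using norm_le_l1_cart[of "u\<^sub>a s \<omega>"] by simp
      then have "norm (u\<^sub>a s \<omega>) * b \<le> real CARD('n) * b"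
        using \<open>0 \<le> b\<close> by (rule mult_right_mono)
      moreover have "norm (x s \<omega>) * a \<le> K * a"
        using K[OF w] \<open>0 \<le> a\<close> by (rule mult_right_mono)
      ultimately show ?thesis
        using a[of "x s \<omega>"] b[of "u\<^sub>a s \<omega>"]
          norm_triangle_ineq[of "A_mat h *v x s \<omega>" "B_mat *v u\<^sub>a s \<omega>"]
        unfolding dynamics[OF w] by linarith
    qed
    moreover have "x (Suc s) \<in> borel_measurable M"
    proof -
      have "(\<lambda>\<omega>. A_mat h *v x s \<omega>) \<in> borel_measurable M"
        using conjunct1[OF Suc.IH] lin(1)
        by (rule measurable_compose[OF _ borel_measurable_continuous_onI[OF linear_continuous_on]])
      moreover have "(\<lambda>\<omega>. B_mat *v u\<^sub>a s \<omega>) \<in> borel_measurable M"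
        using u_measurable[of s] lin(2)
        by (rule measurable_compose[OF _ borel_measurable_continuous_onI[OF linear_continuous_on]])
      ultimately have "(\<lambda>\<omega>. A_mat h *v x s \<omega> + B_mat *v u\<^sub>a s \<omega>) \<in> borel_measurable M"
        by (rule borel_measurable_add)
      moreover have "x (Suc s) \<in> borel_measurable M \<longleftrightarrow>
          (\<lambda>\<omega>. A_mat h *v x s \<omega> + B_mat *v u\<^sub>a s \<omega>) \<in> borel_measurable M"
        by (rule measurable_cong) (rule dynamics)
      ultimately show ?thesis by blast
    qed
    ultimately show ?case by blast
  qed
  note x_meas = this[THEN conjunct1] and x_bdd = this[THEN conjunct2]
  have sub: "subalgebra M F"
    unfolding F_def subalgebra_def using x_meas[of t] by (auto simp: sets_image_in_sets)
  interpret finite_measure_subalgebra M F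
    by standard (rule sub)
  have comp_F: "(\<lambda>\<omega>. x t \<omega> $ r) \<in> borel_measurable F" for r
    unfolding F_def
    by (rule measurable_compose[OF measurable_vimage_algebra1])
       (auto intro!: borel_measurable_continuous_onI continuous_on_component)
  have y_F: "y i \<in> borel_measurable F" for i
    unfolding y_def controller_input_component by (intro borel_measurable_diff comp_F)
  have V_int: "integrable M (\<lambda>\<omega>. V (x s \<omega> - xbar x0))" for s
  proof -
    obtain K where K: "\<And>\<omega>. \<omega> \<in> space M \<Longrightarrow> norm (x s \<omega>) \<le> K" using x_bdd by blast
    have "norm (V (x s \<omega> - xbar x0)) \<le> (K + norm (xbar x0))\<^sup>2" if "\<omega> \<in> space M" for \<omega>
    proof -
      have "norm (x s \<omega> - xbar x0) \<le> K + norm (xbar x0)"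
        using K[OF that] norm_triangle_ineq4[of "x s \<omega>" "xbar x0"] by linarith
      then have "(norm (x s \<omega> - xbar x0))\<^sup>2 \<le> (K + norm (xbar x0))\<^sup>2"
        by (intro power_mono) auto
      then show ?thesis
        using zero_le_power2[of "K + norm (xbar x0)"] zero_le_power2[of "norm (x s \<omega> - xbar x0)"]
        unfolding V_def dot_square_norm real_norm_def by linarith
    qed
    then show ?thesis
      using x_meas[of s] unfolding V_def
      by (intro integrable_const_bound[where B = "(K + norm (xbar x0))\<^sup>2"]) auto
  qed
  have V_F: "(\<lambda>\<omega>. V (x t \<omega> - xbar x0)) \<in> borel_measurable F"
    unfolding V_def inner_vec_def vector_minus_component inner_real_def
    by (intro borel_measurable_times borel_measurable_sum borel_measurable_diff
        borel_measurable_const comp_F)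

  \<comment> \<open>Conditional expectation of the contribution of one route\<close>
  define I where "I i v = (indicator {\<omega> \<in> space M. u\<^sub>a t \<omega> $ i = v} :: 'w \<Rightarrow> real)" for i v
  have u_meas: "(\<lambda>\<omega>. u\<^sub>a t \<omega> $ i) \<in> borel_measurable M" for i
    by (rule measurable_compose[OF u_measurable])
       (auto intro!: borel_measurable_continuous_onI continuous_on_component)
  have I_meas: "I i v \<in> borel_measurable M" for i v
    unfolding I_def using u_meas[of i] by measurable
  have I_int: "integrable M (I i v)" for i v
    by (rule integrable_const_bound[where B = 1]) (auto simp: I_meas, auto simp: I_def indicator_def)
  have y_int: "integrable M (\<lambda>\<omega>. y i \<omega> * I i v \<omega>)" for i v
  proof -
    obtain K where K: "\<And>\<omega>. \<omega> \<in> space M \<Longrightarrow> norm (x t \<omega>) \<le> K" using x_bdd by blast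
    have "norm (y i \<omega> * I i v \<omega>) \<le> 2 * K" if "\<omega> \<in> space M" for \<omega>
    proof -
      have "\<bar>y i \<omega>\<bar> \<le> 2 * K"
        using K[OF that] component_le_norm_cart[of "x t \<omega>" "(i, Outp)"]
          component_le_norm_cart[of "x t \<omega>" "(next_process i, Inp)"]
        unfolding y_def controller_input_component by linarith
      then show ?thesis by (auto simp: I_def indicator_def)
    qed
    then show ?thesis
      by (intro integrable_const_bound[where B = "2 * K"] AE_I2 borel_measurable_times
          measurable_from_subalg[OF sub y_F] I_meas)
  qed
  \<comment> \<open>\<open>g i\<close> is \<open>\<delta> u\<^sub>i\<^sup>2 - u\<^sub>i y\<^sub>i\<close>, in terms of the events whose conditional probabilities are known\<close>
  define g where "g i \<omega> = \<delta> * I i 1 \<omega> + \<delta> * I i (-1) \<omega> + (y i \<omega> * I i (-1) \<omega> - y i \<omega> * I i 1 \<omega>)" for i \<omega>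
  note g_ints = Bochner_Integration.integrable_add Bochner_Integration.integrable_diff
    integrable_mult_right I_int y_int
  have g_int: "integrable M (g i)" for i
    unfolding g_def by (intro g_ints)
  have g_cond: "AE \<omega> in M. real_cond_exp M F (g i) \<omega> \<le> 0" for i
  proof -
    let ?E = "real_cond_exp M F"
    have law: "AE \<omega> in M. ?E (I i v) \<omega> = pmf (actuator (C i (y i \<omega>))) v" for v
      using u_law[of t i v] unfolding I_def F_def y_def .
    \<comment> \<open>The factor \<open>y i\<close> is a function of the conditioning state and can
      be pulled out.\<close>
    have mult: "AE \<omega> in M. ?E (\<lambda>\<omega>. y i \<omega> * I i v \<omega>) \<omega> = y i \<omega> * ?E (I i v) \<omega>" for v
      by (rule real_cond_exp_mult[OF y_F I_meas y_int])
    have scal: "AE \<omega> in M. ?E (\<lambda>\<omega>. \<delta> * I i v \<omega>) \<omega> = \<delta> * ?E (I i v) \<omega>" for v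
      by (rule real_cond_exp_cmult[OF I_int])
    have add1: "AE \<omega> in M. ?E (g i) \<omega> = ?E (\<lambda>\<omega>. \<delta> * I i 1 \<omega> + \<delta> * I i (-1) \<omega>) \<omega>
        + ?E (\<lambda>\<omega>. y i \<omega> * I i (-1) \<omega> - y i \<omega> * I i 1 \<omega>) \<omega>"
      unfolding g_def by (rule real_cond_exp_add) (intro g_ints)+
    have add2: "AE \<omega> in M. ?E (\<lambda>\<omega>. \<delta> * I i 1 \<omega> + \<delta> * I i (-1) \<omega>) \<omega>
        = ?E (\<lambda>\<omega>. \<delta> * I i 1 \<omega>) \<omega> + ?E (\<lambda>\<omega>. \<delta> * I i (-1) \<omega>) \<omega>"
      by (rule real_cond_exp_add) (intro g_ints)+
    have diff: "AE \<omega> in M. ?E (\<lambda>\<omega>. y i \<omega> * I i (-1) \<omega> - y i \<omega> * I i 1 \<omega>) \<omega>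
        = ?E (\<lambda>\<omega>. y i \<omega> * I i (-1) \<omega>) \<omega> - ?E (\<lambda>\<omega>. y i \<omega> * I i 1 \<omega>) \<omega>"
      by (rule real_cond_exp_diff) (intro g_ints)+
    show ?thesis
      using law[of 1] law[of "-1"] mult[of 1] mult[of "-1"] scal[of 1] scal[of "-1"] add1 add2 diff
    proof eventually_elim
      case (elim \<omega>)
      let ?c = "C i (y i \<omega>)"
      have "?E (g i) \<omega> = \<delta> * (max ?c 0 + max (- ?c) 0) + y i \<omega> * (max (- ?c) 0 - max ?c 0)"
        using elim by (simp add: pmf_actuator[OF C_range] algebra_simps)
      also have "max ?c 0 + max (- ?c) 0 = \<bar>?c\<bar>" by (auto simp: max_def)
      also have "max (- ?c) 0 - max ?c 0 = - ?c" by (auto simp: max_def)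
      \<comment> \<open>This is hypothesis (ii) at the realised input
        \<open>y i \<omega>\<close>.\<close>
      also have "\<delta> * \<bar>?c\<bar> + y i \<omega> * - ?c \<le> 0"
        using C_cascade[of i "y i \<omega>"] unfolding expectation_actuator[OF C_range]
        by (simp add: mult.commute)
      finally show ?case .
    qed
  qed

  \<comment> \<open>Pathwise bound and passage to conditional expectations\<close>
  have step: "V (x (Suc t) \<omega> - xbar x0) \<le> V (x t \<omega> - xbar x0) + (\<Sum>i\<in>UNIV. g i \<omega>)"
    if w: "\<omega> \<in> space M" for \<omega>
  proof -
    have "x (Suc t) \<omega> - xbar x0 = A_mat h *v (x t \<omega> - xbar x0) + B_mat *v u\<^sub>a t \<omega>"
      by (simp add: dynamics[OF w] matrix_vector_mult_diff_distrib A_mat_xbar)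
    then have "V (x (Suc t) \<omega> - xbar x0) \<le> V (x t \<omega> - xbar x0)
        + (\<Sum>i\<in>UNIV. (u\<^sub>a t \<omega> $ i)\<^sup>2 / (1 - h) - u\<^sub>a t \<omega> $ i * y i \<omega>)"
      using V_step_le[OF \<open>0 < h\<close> \<open>h < 1\<close>, of "x t \<omega> - xbar x0" "u\<^sub>a t \<omega>"]
      by (simp add: controller_input_xbar y_def)
    also have "(\<Sum>i\<in>UNIV. (u\<^sub>a t \<omega> $ i)\<^sup>2 / (1 - h) - u\<^sub>a t \<omega> $ i * y i \<omega>) \<le> (\<Sum>i\<in>UNIV. g i \<omega>)"
    proof (rule sum_mono)
      fix i
      have "2 * gamma_m h = 1 / (1 - h)"
        using \<open>h < 1\<close> by (simp add: gamma_m_def field_simps)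
      then have "1 / (1 - h) \<le> \<delta>" using \<open>\<delta> \<ge> 2 * gamma_m h\<close> by simp
      \<comment> \<open>For flow 0 both sides vanish; for flow 1 or -1 the square is 1, the terms in
        \<open>y i\<close> agree, and the claim is the bound on \<open>\<delta>\<close>.\<close>
      then show "(u\<^sub>a t \<omega> $ i)\<^sup>2 / (1 - h) - u\<^sub>a t \<omega> $ i * y i \<omega> \<le> g i \<omega>"
        using u_values[OF w, of t i] w unfolding g_def I_def by auto
    qed
    finally show ?thesis by simp
  qed
  have sum_int: "integrable M (\<lambda>\<omega>. \<Sum>i\<in>UNIV. g i \<omega>)"
    by (intro Bochner_Integration.integrable_sum g_int)
  have mono: "AE \<omega> in M. real_cond_exp M F (\<lambda>\<omega>. V (x (Suc t) \<omega> - xbar x0)) \<omega>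
      \<le> real_cond_exp M F (\<lambda>\<omega>. V (x t \<omega> - xbar x0) + (\<Sum>i\<in>UNIV. g i \<omega>)) \<omega>"
    using step by (intro real_cond_exp_mono V_int Bochner_Integration.integrable_add sum_int) auto
  have split: "AE \<omega> in M. real_cond_exp M F (\<lambda>\<omega>. V (x t \<omega> - xbar x0) + (\<Sum>i\<in>UNIV. g i \<omega>)) \<omega>
      = real_cond_exp M F (\<lambda>\<omega>. V (x t \<omega> - xbar x0)) \<omega>
      + real_cond_exp M F (\<lambda>\<omega>. \<Sum>i\<in>UNIV. g i \<omega>) \<omega>"
    by (rule real_cond_exp_add[OF V_int sum_int])
  have V_cond: "AE \<omega> in M. real_cond_exp M F (\<lambda>\<omega>. V (x t \<omega> - xbar x0)) \<omega> = V (x t \<omega> - xbar x0)"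
    by (rule real_cond_exp_F_meas[OF V_int V_F])
  \<comment> \<open>By linearity the marginal conditional law of each route suffices, whatever the
    dependence between routes.\<close>
  have sum_cond: "AE \<omega> in M. real_cond_exp M F (\<lambda>\<omega>. \<Sum>i\<in>UNIV. g i \<omega>) \<omega>
      = (\<Sum>i\<in>UNIV. real_cond_exp M F (g i) \<omega>)"
    by (rule real_cond_exp_sum[OF g_int])
  \<comment> \<open>There are finitely many routes, so their exceptional null sets can be
    united.\<close>
  have all: "AE \<omega> in M. \<forall>i\<in>UNIV. real_cond_exp M F (g i) \<omega> \<le> 0"
    by (rule AE_finite_allI) (auto intro: g_cond)
  have "AE \<omega> in M. real_cond_exp M F (\<lambda>\<omega>. V (x (Suc t) \<omega> - xbar x0)) \<omega>
      - V (x t \<omega> - xbar x0) \<le> 0"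
    using mono split V_cond sum_cond all
  proof eventually_elim
    case (elim \<omega>)
    have "(\<Sum>i\<in>UNIV. real_cond_exp M F (g i) \<omega>) \<le> 0" using elim by (intro sum_nonpos) auto
    then show ?case using elim by linarith
  qed
  then show "AE \<omega> in M. real_cond_exp M (vimage_algebra (space M) (\<lambda>\<omega>'. x t \<omega>' - xbar x0) borel)
        (\<lambda>\<omega>'. V (x (Suc t) \<omega>' - xbar x0)) \<omega> - V (x t \<omega> - xbar x0) \<le> 0"
    unfolding vimage_algebra_diff_const F_def .
qed

end
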